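(* Let $G$ be a structured bilinear SISO system given by $\mathcal{C},\mathcal{K},\mathcal{N},\mathcal{B}$, with subsystem transfer functions $G_k$, and let $\widehat G$, with subsystem transfer functions $\widehat G_k$, be the reduced-order bilinear SISO system constructed by projection with $W,V\in\mathbb{C}^{n\times r}$. Let $\sigma_1,\ldots,\sigma_k\in\mathbb{C}$ and $\varsigma_1,\ldots,\varsigma_\theta\in\mathbb{C}$ be two sets of interpolation points at which the matrix functions $\mathcal{C}(s)$, $\mathcal{K}(s)^{-1}$, $\mathcal{N}(s)$ and $\mathcal{B}(s)$ are analytic and $\widehat{\mathcal{K}}(s)$ is full-rank, and let $\ell_1,\ldots,\ell_k\ge0$ and $\nu_1,\ldots,\nu_\theta\ge 0$ be integers (orders of partial derivatives). Let \[ v_{1,j_1}=\partial_{s^{j_1}}(\mathcal{K}^{-1}\mathcal{B})(\sigma_1),\qquad j_1=0,\ldots,\ell_1, \] and, for $2\le q\le k$, \[ v_{q,j_q}=\partial_{s^{j_q}}\mathcal{K}^{-1}(\sigma_q)\Big(\prod_{j=1}^{q-2}\partial_{s^{\ell_{q-j}}}(\mathcal{N}\mathcal{K}^{-1})(\sigma_{q-j})\Big)\partial_{s^{\ell_1}}(\mathcal{N}\mathcal{K}^{-1}\mathcal{B})(\sigma_1),\qquad j_q=0,\ldots,\ell_q, \] and let $V$ be such that $\operatorname{span}(V)$ contains all the vectors $v_{q,j_q}$, $1\le q\le k$, $0\le j_q\le\ell_q$. Let \[ w_{1,i_\theta}=\partial_{s^{i_\theta}}(\mathcal{K}^{-\mathsf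 H}\mathcal{C}^{\mathsf H})(\varsigma_\theta),\qquad i_\theta=0,\ldots,\nu_\theta, \] and, for $2\le \eta\le \theta$, \[ w_{\eta,i_{\theta-\eta+1}}=\partial_{s^{i_{\theta-\eta+1}}}(\mathcal{K}^{-\mathsf H}\mathcal{N}^{\mathsf H})(\varsigma_{\theta-\eta+1})\Big(\prod_{j=\theta-\eta+2}^{\theta-1}\partial_{s^{\nu_j}}(\mathcal{K}^{-\mathsf H}\mathcal{N}^{\mathsf H})(\varsigma_j)\Big)\partial_{s^{\nu_\theta}}(\mathcal{K}^{-\mathsf H}\mathcal{C}^{\mathsf H})(\varsigma_\theta), \] $i_{\theta-\eta+1}=0,\ldots,\nu_{\theta-\eta+1}$, and let $W$ be such that $\operatorname{span}(W)$ contains all the vectors $w_{\eta,i_{\theta-\eta+1}}$, $1\le\eta\le\theta$, $0\le i_{\theta-\eta+1}\le\nu_{\theta-\eta+1}$. Then, for each $1\le q\le k$, \[ \partial_{s_1^{\ell_1}\cdots s_{q-1}^{\ell_{q-1}}s_q^{j_q}}G_q(\sigma_1,\ldots,\sigma_q)=\partial_{s_1^{\ell_1}\cdots s_{q-1}^{\ell_{q-1}}s_q^{j_q}}\widehat G_q(\sigma_1,\ldots,\sigma_q),\qquad j_q=0,\ldots,\ell_q; \] for each $1\le\eta\le\theta$, \[ \partial_{s_1^{i_{\theta-\eta+1}}s_2^{\nu_{\theta-\eta+2}}\cdots s_\eta^{\nu_\theta}}G_\eta(\varsigma_{\theta-\eta+1},\ldots,\varsigma_\theta)=\partial_{s_1^{i_{\theta-\eta+1}}s_2^{\nu_{\theta-\eta+2}}\cdots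 s_\eta^{\nu_\theta}}\widehat G_\eta(\varsigma_{\theta-\eta+1},\ldots,\varsigma_\theta),\qquad i_{\theta-\eta+1}=0,\ldots,\nu_{\theta-\eta+1}; \] and additionally \[ \begin{aligned} &\partial_{s_1^{\ell_1}\cdots s_{q-1}^{\ell_{q-1}}s_q^{j_q}s_{q+1}^{i_{\theta-\eta+1}}s_{q+2}^{\nu_{\theta-\eta+2}}\cdots s_{q+\eta}^{\nu_\theta}}G_{q+\eta}(\sigma_1,\ldots,\sigma_q,\varsigma_{\theta-\eta+1},\ldots,\varsigma_\theta)\\ &=\partial_{s_1^{\ell_1}\cdots s_{q-1}^{\ell_{q-1}}s_q^{j_q}s_{q+1}^{i_{\theta-\eta+1}}s_{q+2}^{\nu_{\theta-\eta+2}}\cdots s_{q+\eta}^{\nu_\theta}}\widehat G_{q+\eta}(\sigma_1,\ldots,\sigma_q,\varsigma_{\theta-\eta+1},\ldots,\varsigma_\theta) \end{aligned} \] for all $j_q=0,\ldots,\ell_q$; $i_{\theta-\eta+1}=0,\ldots,\nu_{\theta-\eta+1}$; $1\le q\le k$ and $1\le\eta\le\theta$.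
   Context: A structured bilinear SISO (single-input single-output) system $G$ is described by matrix-valued functions of a complex variable $\mathcal{C}\colon\mathbb{C}\to\mathbb{C}^{1\times n}$, $\mathcal{K}\colon\mathbb{C}\to\mathbb{C}^{n\times n}$, $\mathcal{N}\colon\mathbb{C}\to\mathbb{C}^{n\times n}$, $\mathcal{B}\colon\mathbb{C}\to\mathbb{C}^{n\times 1}$ (which may fail to be defined, or $\mathcal{K}$ may fail to be invertible, at some points), through its regular subsystem transfer functions \[ G_k(s_1,\ldots,s_k)=\mathcal{C}(s_k)\mathcal{K}(s_k)^{-1}\Big(\prod_{j=1}^{k-1}\mathcal{N}(s_{k-j})\mathcal{K}(s_{k-j})^{-1}\Big)\mathcal{B}(s_1),\qquad k\ge 1 . \] Products $\prod_{j=a}^{b}A_j$ of matrices are ordered $A_aA_{a+1}\cdots A_b$; empty products are identities. Given model reduction bases (truncation matrices) $W,V\in\mathbb{C}^{n\times r}$, the reduced-order system $\widehat G$ is given by \[ \widehat{\mathcal{C}}(s)=\mathcal{C}(s)V,\quad \widehat{\mathcal{K}}(s)=W^{\mathsf H}\mathcal{K}(s)V,\quad \widehat{\mathcal{B}}(s)=W^{\mathsf H}\mathcal{B}(s),\quad \widehat{\mathcal{N}}(s)=W^{\mathsf H}\mathcal{N}(s)V, \] and its transfer functions $\widehat G_k$ are defined by the same formula with hatted quantities. Here $^{\mathsf H}$ is the conjugate transpose and $\operatorname{span}$ of a matrix is its column space. Partial (complex) derivatives are denoted by \[ \partial_{s_1^{j_1}\cdots s_k^{j_k}}f(z_1,\ldots,z_k):=\frac{\partial^{j_1+\cdots+j_k}f}{\partial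 s_1^{j_1}\cdots\partial s_k^{j_k}}(z_1,\ldots,z_k); \] for a function $F$ of a single variable $s$, $\partial_{s^j}F(\sigma)$ is its $j$-th derivative at $\sigma$. Products of matrix functions are pointwise. Derivatives of Hermitian conjugated functions are understood as Hermitian conjugates of derivatives: $\partial_{s^j}(\mathcal{K}^{-\mathsf H}\mathcal{C}^{\mathsf H})(\sigma):=\big(\partial_{s^j}(\mathcal{C}\mathcal{K}^{-1})(\sigma)\big)^{\mathsf H}$ and $\partial_{s^j}(\mathcal{K}^{-\mathsf H}\mathcal{N}^{\mathsf H})(\sigma):=\big(\partial_{s^j}(\mathcal{N}\mathcal{K}^{-1})(\sigma)\big)^{\mathsf H}$. *)

theory Defs
  imports "HOL-Analysis.Analysis"
begin

definition conj_transpose :: "complex^'n^'m \<Rightarrow> complex^'m^'n" where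
  "conj_transpose A = map_matrix cnj (transpose A)"

text \<open>The ordered product \<open>A a ** A (a+1) ** \<dots> ** A b\<close>; it is the identity if \<open>b < a\<close>.\<close>

definition ordered_prod :: "(nat \<Rightarrow> complex^'n^'n) \<Rightarrow> nat \<Rightarrow> nat \<Rightarrow> complex^'n^'n" where
  "ordered_prod A a b = foldr (\<lambda>j P. A j ** P) [a..<Suc b] (mat 1)"

definition mat_analytic_at :: "(complex \<Rightarrow> complex^'n^'m) \<Rightarrow> complex \<Rightarrow> bool" where
  "mat_analytic_at F z \<longleftrightarrow> (\<forall>i j. (\<lambda>s. F s $ i $ j) analytic_on {z})"

text \<open>Since \<open>matrix_inv\<close> is a total function with an unspecified value at singular matrices,
  analyticity of the pointwise inverse includes its existence near the point.\<close>

definition inv_analytic_at :: "(complex \<Rightarrow> complex^'n^'n) \<Rightarrow> complex \<Rightarrow> bool" where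
  "inv_analytic_at K z \<longleftrightarrow>
     (\<forall>\<^sub>F s in nhds z. invertible (K s)) \<and> mat_analytic_at (\<lambda>s. matrix_inv (K s)) z"

definition mat_deriv :: "nat \<Rightarrow> (complex \<Rightarrow> complex^'n^'m) \<Rightarrow> complex \<Rightarrow> complex^'n^'m" where
  "mat_deriv p F z = (\<chi> i j. (deriv ^^ p) (\<lambda>s. F s $ i $ j) z)"

text \<open>Functions of \<open>k\<close> complex variables are functions of \<open>s :: nat \<Rightarrow> complex\<close> that depend on
  \<open>s 1, \<dots>, s k\<close> only. \<open>mixed_partial k p f\<close> is the derivative of \<open>f\<close> of order \<open>p m\<close> in the
  \<open>m\<close>-th variable, \<open>1 \<le> m \<le> k\<close>; as in the Leibniz notation, the \<open>k\<close>-th variable is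
  differentiated first.\<close>

definition partial ::
  "nat \<Rightarrow> nat \<Rightarrow> ((nat \<Rightarrow> complex) \<Rightarrow> complex) \<Rightarrow> (nat \<Rightarrow> complex) \<Rightarrow> complex" where
  "partial m p f z = (deriv ^^ p) (\<lambda>t. f (z(m := t))) (z m)"

fun mixed_partial ::
  "nat \<Rightarrow> (nat \<Rightarrow> nat) \<Rightarrow> ((nat \<Rightarrow> complex) \<Rightarrow> complex) \<Rightarrow> (nat \<Rightarrow> complex) \<Rightarrow> complex" where
  "mixed_partial 0 p f = f"
| "mixed_partial (Suc k) p f = mixed_partial k p (partial (Suc k) (p (Suc k)) f)"

text \<open>The \<open>k\<close>-th regular subsystem transfer function, \<open>k \<ge> 1\<close>; the indices \<open>1\<close> select the entry of
  a \<open>1 \<times> 1\<close> matrix.\<close>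

definition transfer_fun ::
  "(complex \<Rightarrow> complex^'n^1) \<Rightarrow> (complex \<Rightarrow> complex^'n^'n) \<Rightarrow> (complex \<Rightarrow> complex^'n^'n) \<Rightarrow>
   (complex \<Rightarrow> complex^1^'n) \<Rightarrow> nat \<Rightarrow> (nat \<Rightarrow> complex) \<Rightarrow> complex" where
  "transfer_fun C K N B k s =
     (C (s k) ** matrix_inv (K (s k))
        ** ordered_prod (\<lambda>j. N (s (k - j)) ** matrix_inv (K (s (k - j)))) 1 (k - 1)
        ** B (s 1)) $ 1 $ 1"

definition reduced_transfer_fun ::
  "complex^'r^'n \<Rightarrow> complex^'r^'n \<Rightarrow>
   (complex \<Rightarrow> complex^'n^1) \<Rightarrow> (complex \<Rightarrow> complex^'n^'n) \<Rightarrow> (complex \<Rightarrow> complex^'n^'n) \<Rightarrow>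
   (complex \<Rightarrow> complex^1^'n) \<Rightarrow> nat \<Rightarrow> (nat \<Rightarrow> complex) \<Rightarrow> complex" where
  "reduced_transfer_fun W V C K N B =
     transfer_fun (\<lambda>s. C s ** V) (\<lambda>s. conj_transpose W ** K s ** V)
       (\<lambda>s. conj_transpose W ** N s ** V) (\<lambda>s. conj_transpose W ** B s)"

definition admissible_point ::
  "complex^'r^'n \<Rightarrow> complex^'r^'n \<Rightarrow>
   (complex \<Rightarrow> complex^'n^1) \<Rightarrow> (complex \<Rightarrow> complex^'n^'n) \<Rightarrow> (complex \<Rightarrow> complex^'n^'n) \<Rightarrow>
   (complex \<Rightarrow> complex^1^'n) \<Rightarrow> complex \<Rightarrow> bool" where
  "admissible_point W V C K N B z \<longleftrightarrow>
     mat_analytic_at C z \<and> inv_analytic_at K z \<and> mat_analytic_at N z \<and> mat_analytic_at B z \<and>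
     rank (conj_transpose W ** K z ** V) = CARD('r)"

text \<open>\<open>splice_at q a b\<close> is the sequence \<open>a 1, \<dots>, a q, b 1, b 2, \<dots>\<close>, indexed from \<open>1\<close>.\<close>

definition splice_at :: "nat \<Rightarrow> (nat \<Rightarrow> 'a) \<Rightarrow> (nat \<Rightarrow> 'a) \<Rightarrow> nat \<Rightarrow> 'a" where
  "splice_at q a b m = (if m \<le> q then a m else b (m - q))"

end

(* Every variable enters a transfer function through its own factor, so a mixed partial derivative
   is the ordered product of the derivatives of the factors and no theory of several complex
   variables is needed. The reduced transfer functions arise from the original ones by replacing
   X = K^-1 by R = V (W^H K V)^-1 W^H. Since R = (R K) X, and R K fixes the column space of V near
   each interpolation point, derivatives of X b that lie in that space up to some order are also
   the derivatives of R b; induction over the variables gives the interpolation conditions from the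
   right. Dually R = X (K R) and W^H (K R) = W^H give those from the left. In the mixed case the two
   inductions meet at the factor N, which both systems share. *)
theory Submission
  imports Defs "HOL-Complex_Analysis.Complex_Analysis"
begin

unbundle no Formal_Power_Series.fps_syntax

section \<open>Analytic matrix functions\<close>

lemma mat_analytic_at_const [intro, simp]: "mat_analytic_at (\<lambda>_. A) z"
  by (simp add: mat_analytic_at_def)

lemma mat_analytic_at_mult [intro]:
  assumes "mat_analytic_at F z" "mat_analytic_at G z"
  shows "mat_analytic_at (\<lambda>s. F s ** G s) z"
  using assms unfolding mat_analytic_at_def matrix_matrix_mult_def
  by (auto intro!: analytic_intros)

lemma mat_analytic_at_cong:
  assumes "\<forall>\<^sub>F s in nhds z. F s = G s"
  shows "mat_analytic_at F z \<longleftrightarrow> mat_analytic_at G z"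
proof -
  have "(\<lambda>s. F s $ i $ j) analytic_on {z} \<longleftrightarrow> (\<lambda>s. G s $ i $ j) analytic_on {z}" for i j
    by (rule analytic_at_cong) (use assms in \<open>auto elim: eventually_mono\<close>)
  then show ?thesis by (simp add: mat_analytic_at_def)
qed

section \<open>Inverses of matrices and of analytic matrix functions\<close>

lemma matrix_inv_mult:
  fixes A :: "complex^'n^'n"
  assumes "invertible A"
  shows "A ** matrix_inv A = mat 1" "matrix_inv A ** A = mat 1"
proof -
  have "A ** matrix_inv A = mat 1 \<and> matrix_inv A ** A = mat 1"
    unfolding matrix_inv_def by (rule someI_ex) (use assms in \<open>simp add: invertible_def\<close>)
  then show "A ** matrix_inv A = mat 1" "matrix_inv A ** A = mat 1" by auto
qed

lemma matrix_inv_unique: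
  fixes A B :: "complex^'n^'n"
  assumes "A ** B = mat 1"
  shows "matrix_inv A = B"
proof -
  have "invertible A" using assms invertible_right_inverse by blast
  then have "matrix_inv A ** (A ** B) = B"
    by (simp add: matrix_mul_assoc matrix_inv_mult)
  then show ?thesis using assms by simp
qed

text \<open>Column \<open>m\<close> of the inverse solves the linear system whose right-hand side is
  the \<open>m\<close>-th unit vector, so Cramer's rule applies. The quotient of determinants makes
  the analyticity of the inverse visible, because \<open>det\<close> is a polynomial in the
  entries.\<close>

lemma matrix_inv_cramer:
  fixes A :: "complex^'n^'n"
  assumes "det A \<noteq> 0"
  shows "matrix_inv A $ k $ m
    = det (\<chi> i j. if j = k then (if i = m then 1 else 0) else A $ i $ j) / det A"
proof -
  have inv: "invertible A" using assms by (simp add: invertible_det_nz)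
  have "A *v (matrix_inv A *v axis m 1) = axis m 1"
    by (simp add: matrix_vector_mul_assoc matrix_inv_mult inv)
  then have "matrix_inv A *v axis m 1
      = (\<chi> k. det (\<chi> i j. if j = k then axis m 1 $ i else A $ i $ j) / det A)"
    using cramer[OF assms] by blast
  then have "(matrix_inv A *v axis m 1) $ k
      = det (\<chi> i j. if j = k then axis m 1 $ i else A $ i $ j) / det A"
    by simp
  moreover have "(matrix_inv A *v axis m 1) $ k = matrix_inv A $ k $ m"
    by (simp add: matrix_vector_mult_def axis_def if_distrib[of "(*) _"] cong: if_cong)
  ultimately show ?thesis
    by (simp add: axis_def eq_commute cong: if_cong)
qed

lemma analytic_det:
  fixes F :: "complex \<Rightarrow> complex^'n^'n"
  assumes "mat_analytic_at F z"
  shows "(\<lambda>s. det (F s)) analytic_on {z}"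
  using assms unfolding det_def mat_analytic_at_def by (auto intro!: analytic_intros)

text \<open>The determinant is continuous at \<open>z\<close>, so it stays nonzero nearby.\<close>

lemma eventually_invertible:
  fixes F :: "complex \<Rightarrow> complex^'n^'n"
  assumes "mat_analytic_at F z" "invertible (F z)"
  shows "\<forall>\<^sub>F s in nhds z. invertible (F s)"
proof -
  have "isCont (\<lambda>s. det (F s)) z"
    using analytic_det[OF assms(1)] by (rule analytic_at_imp_isCont)
  then have "((\<lambda>s. det (F s)) \<longlongrightarrow> det (F z)) (nhds z)"
    unfolding isCont_def by (rule tendsto_at_iff_tendsto_nhds[THEN iffD1])
  then have "\<forall>\<^sub>F s in nhds z. det (F s) \<noteq> 0"
    using assms(2) by (intro tendsto_imp_eventually_ne) (auto simp: invertible_det_nz)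
  then show ?thesis by (simp add: invertible_det_nz)
qed

lemma mat_analytic_at_matrix_inv:
  fixes F :: "complex \<Rightarrow> complex^'n^'n"
  assumes "mat_analytic_at F z" "invertible (F z)"
  shows "mat_analytic_at (\<lambda>s. matrix_inv (F s)) z"
  unfolding mat_analytic_at_def
proof (intro allI)
  fix k m
  let ?D = "\<lambda>s. (\<chi> i j. if j = k then (if i = m then 1 else 0) else F s $ i $ j) :: complex^'n^'n"
  have "mat_analytic_at ?D z"
    unfolding mat_analytic_at_def
  proof (intro allI)
    fix i j
    show "(\<lambda>s. ?D s $ i $ j) analytic_on {z}"
      using assms(1) by (cases "j = k") (auto simp: mat_analytic_at_def)
  qed
  then have "(\<lambda>s. det (?D s) / det (F s)) analytic_on {z}"
    using assms by (intro analytic_on_divide analytic_det) (auto simp: invertible_det_nz)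
  \<comment> \<open>Cramer's rule needs a nonzero determinant, so the quotient is identified with
    the entry only near \<open>z\<close>; analyticity at \<open>z\<close> depends on nothing
    more.\<close>
  moreover have "\<forall>\<^sub>F s in nhds z. det (?D s) / det (F s) = matrix_inv (F s) $ k $ m"
    using eventually_invertible[OF assms]
    by (rule eventually_mono) (simp add: matrix_inv_cramer invertible_det_nz)
  ultimately show "(\<lambda>s. matrix_inv (F s) $ k $ m) analytic_on {z}"
    by (rule analytic_at_cong[OF _ refl, THEN iffD1, rotated])
qed

text \<open>The interpolation points are only assumed to be points of analyticity of the inverse of
  \<open>K\<close>. Analyticity of \<open>K\<close> itself follows because near \<open>z\<close> it
  is the inverse of its inverse.\<close>

lemma inv_analytic_at_imp_analytic:
  assumes "inv_analytic_at K z"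
  shows "mat_analytic_at K z"
proof -
  have ev: "\<forall>\<^sub>F s in nhds z. invertible (K s)"
    and an: "mat_analytic_at (\<lambda>s. matrix_inv (K s)) z"
    using assms by (auto simp: inv_analytic_at_def)
  have "invertible (K z)" using ev eventually_nhds_x_imp_x by blast
  then have "invertible (matrix_inv (K z))"
    using matrix_inv_mult invertible_def by blast
  with an have "mat_analytic_at (\<lambda>s. matrix_inv (matrix_inv (K s))) z"
    by (rule mat_analytic_at_matrix_inv)
  moreover have "\<forall>\<^sub>F s in nhds z. matrix_inv (matrix_inv (K s)) = K s"
    using ev by (rule eventually_mono) (auto intro: matrix_inv_unique matrix_inv_mult)
  ultimately show ?thesis by (rule mat_analytic_at_cong[THEN iffD1, rotated])
qed

lemma full_rank_invertible:
  fixes A :: "complex^'n^'n"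
  assumes "rank A = CARD('n)"
  shows "invertible A"
proof -
  have "vec.span (rows A) = UNIV"
    using assms unfolding row_rank_def_gen by (metis vec.dim_eq_full vec.span_UNIV vec_dim_card)
  then show ?thesis
    by (simp add: invertible_left_inverse matrix_left_invertible_span_rows_gen)
qed

section \<open>Derivatives of matrix functions\<close>

lemma mat_deriv_0 [simp]: "mat_deriv 0 F z = F z"
  by (simp add: mat_deriv_def vec_eq_iff)

lemma mat_deriv_const: "mat_deriv p (\<lambda>_. A) z = (if p = 0 then A else 0)"
  by (simp add: mat_deriv_def vec_eq_iff)

lemma mat_deriv_cong:
  assumes "\<forall>\<^sub>F s in nhds z. F s = G s"
  shows "mat_deriv p F z = mat_deriv p G z"
proof -
  have "(deriv ^^ p) (\<lambda>s. F s $ i $ j) z = (deriv ^^ p) (\<lambda>s. G s $ i $ j) z" for i j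
    by (rule higher_deriv_cong_ev) (use assms in \<open>auto elim: eventually_mono\<close>)
  then show ?thesis by (simp add: mat_deriv_def)
qed

lemma higher_deriv_sum_at:
  assumes "finite I" "\<And>i. i \<in> I \<Longrightarrow> f i analytic_on {z}"
  shows "(deriv ^^ p) (\<lambda>s. \<Sum>i\<in>I. f i s) z = (\<Sum>i\<in>I. (deriv ^^ p) (f i) z)"
  using assms
proof (induction I rule: finite_induct)
  case (insert x I)
  then show ?case
    by (simp add: higher_deriv_add_at analytic_on_sum)
qed auto

text \<open>The scalar Leibniz rule is applied to each summand of an entry of the product;
  exchanging the two finite sums reassembles matrix products.\<close>

lemma mat_deriv_mult:
  fixes F :: "complex \<Rightarrow> complex^'m^'a" and G :: "complex \<Rightarrow> complex^'b^'m"
  assumes "mat_analytic_at F z" "mat_analytic_at G z"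
  shows "mat_deriv p (\<lambda>s. F s ** G s) z
    = (\<Sum>i\<le>p. real (p choose i) *\<^sub>R (mat_deriv i F z ** mat_deriv (p - i) G z))"
proof -
  have F: "(\<lambda>s. F s $ i $ j) analytic_on {z}" for i j
    using assms by (simp add: mat_analytic_at_def)
  have G: "(\<lambda>s. G s $ i $ j) analytic_on {z}" for i j
    using assms by (simp add: mat_analytic_at_def)
  have "(deriv ^^ p) (\<lambda>s. (F s ** G s) $ a $ b) z
    = (\<Sum>i\<le>p. real (p choose i) *\<^sub>R (mat_deriv i F z ** mat_deriv (p - i) G z)) $ a $ b" for a b
  proof -
    have "(deriv ^^ p) (\<lambda>s. (F s ** G s) $ a $ b) z
        = (\<Sum>c\<in>UNIV. (deriv ^^ p) (\<lambda>s. F s $ a $ c * G s $ c $ b) z)"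
      unfolding matrix_matrix_mult_def
      by (simp add: higher_deriv_sum_at analytic_on_mult F G)
    also have "\<dots> = (\<Sum>c\<in>UNIV. \<Sum>i\<le>p. of_nat (p choose i)
        * (deriv ^^ i) (\<lambda>s. F s $ a $ c) z * (deriv ^^ (p - i)) (\<lambda>s. G s $ c $ b) z)"
      by (simp add: higher_deriv_mult_at F G atLeast0AtMost)
    also have "\<dots> = (\<Sum>i\<le>p. \<Sum>c\<in>UNIV. of_nat (p choose i)
        * (deriv ^^ i) (\<lambda>s. F s $ a $ c) z * (deriv ^^ (p - i)) (\<lambda>s. G s $ c $ b) z)"
      by (rule sum.swap)
    also have "\<dots> = (\<Sum>i\<le>p. real (p choose i)
        *\<^sub>R (mat_deriv i F z ** mat_deriv (p - i) G z)) $ a $ b"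
      by (simp add: mat_deriv_def matrix_matrix_mult_def scaleR_conv_of_real[where 'a = complex]
          sum_distrib_left mult.assoc)
    finally show ?thesis .
  qed
  then show ?thesis unfolding mat_deriv_def[of p "\<lambda>s. F s ** G s"] by (simp add: vec_eq_iff)
qed

lemma mat_deriv_mult_const_left:
  assumes "mat_analytic_at G z"
  shows "mat_deriv p (\<lambda>s. A ** G s) z = A ** mat_deriv p G z"
proof -
  have "mat_deriv p (\<lambda>s. A ** G s) z
      = (\<Sum>i\<le>p. if i = 0 then A ** mat_deriv p G z else 0)"
    unfolding mat_deriv_mult[OF mat_analytic_at_const assms]
    by (rule sum.cong) (auto simp: mat_deriv_const)
  then show ?thesis by simp
qed

lemma mat_deriv_mult_const_right:
  assumes "mat_analytic_at F z"
  shows "mat_deriv p (\<lambda>s. F s ** A) z = mat_deriv p F z ** A"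
proof -
  have "mat_deriv p (\<lambda>s. F s ** A) z
      = (\<Sum>i\<le>p. if i = p then mat_deriv p F z ** A else 0)"
    unfolding mat_deriv_mult[OF assms mat_analytic_at_const]
    by (rule sum.cong) (auto simp: mat_deriv_const)
  then show ?thesis by simp
qed

text \<open>The Leibniz formula only involves derivatives at \<open>z\<close> of order at most
  \<open>p\<close>. Hence agreement of the factors to that order at the single point is enough,
  without equality near \<open>z\<close>.\<close>

lemma mat_deriv_mult_cong:
  assumes "mat_analytic_at F z" "mat_analytic_at G z" "mat_analytic_at F' z" "mat_analytic_at G' z"
    and "\<And>i. i \<le> p \<Longrightarrow> mat_deriv i F z = mat_deriv i F' z"
    and "\<And>i. i \<le> p \<Longrightarrow> mat_deriv i G z = mat_deriv i G' z"
  shows "mat_deriv p (\<lambda>s. F s ** G s) z = mat_deriv p (\<lambda>s. F' s ** G' s) z"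
  using assms by (simp add: mat_deriv_mult)

section \<open>Projection preserves the derivatives\<close>

text \<open>Here \<open>X\<close> is \<open>K\<^sup>-\<^sup>1\<close> and \<open>R = V (W\<^sup>H K V)\<^sup>-\<^sup>1 W\<^sup>H\<close>, so that \<open>R K\<close> is a projection onto the
  column space of \<open>V\<close> and \<open>K R\<close> acts as the identity on the row space of \<open>U = W\<^sup>H\<close>.\<close>

definition projects_at ::
  "(complex \<Rightarrow> complex^'n^'n) \<Rightarrow> (complex \<Rightarrow> complex^'n^'n) \<Rightarrow> (complex \<Rightarrow> complex^'n^'n) \<Rightarrow>
   complex^'n^'r \<Rightarrow> complex^'r^'n \<Rightarrow> complex \<Rightarrow> bool" where
  "projects_at K X R U V z \<longleftrightarrow>
     mat_analytic_at K z \<and> mat_analytic_at X z \<and> mat_analytic_at R z \<and>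
     (\<forall>\<^sub>F s in nhds z. K s ** X s = mat 1 \<and> X s ** K s = mat 1 \<and>
        R s ** K s ** V = V \<and> U ** K s ** R s = U)"

text \<open>In both projection identities the reduced matrix meets its own inverse and cancels. Its
  invertibility is assumed at \<open>z\<close> only and extends to a neighbourhood by
  analyticity.\<close>

lemma projects_atI:
  fixes W V :: "complex^'r^'n"
  assumes "inv_analytic_at K z" "rank (conj_transpose W ** K z ** V) = CARD('r)"
  shows "projects_at K (\<lambda>s. matrix_inv (K s))
    (\<lambda>s. V ** matrix_inv (conj_transpose W ** K s ** V) ** conj_transpose W) (conj_transpose W) V z"
proof -
  let ?U = "conj_transpose W"
  let ?H = "\<lambda>s. ?U ** K s ** V"
  have K: "mat_analytic_at K z" using assms(1) by (rule inv_analytic_at_imp_analytic)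
  have H: "mat_analytic_at ?H z" by (intro mat_analytic_at_mult mat_analytic_at_const K)
  have iH: "invertible (?H z)" using assms(2) by (rule full_rank_invertible)
  have "\<forall>\<^sub>F s in nhds z. invertible (K s)" using assms(1) by (simp add: inv_analytic_at_def)
  moreover have "\<forall>\<^sub>F s in nhds z. invertible (?H s)" using H iH by (rule eventually_invertible)
  ultimately have "\<forall>\<^sub>F s in nhds z. K s ** matrix_inv (K s) = mat 1 \<and> matrix_inv (K s) ** K s = mat 1 \<and>
        V ** matrix_inv (?H s) ** ?U ** K s ** V = V \<and>
        ?U ** K s ** (V ** matrix_inv (?H s) ** ?U) = ?U"
  proof eventually_elim
    case (elim s)
    have "V ** matrix_inv (?H s) ** ?U ** K s ** V = V ** (matrix_inv (?H s) ** ?H s)"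
      by (simp add: matrix_mul_assoc)
    moreover have "?U ** K s ** (V ** matrix_inv (?H s) ** ?U) = (?H s ** matrix_inv (?H s)) ** ?U"
      by (simp add: matrix_mul_assoc)
    ultimately show ?case using elim by (simp add: matrix_inv_mult)
  qed
  moreover have "mat_analytic_at (\<lambda>s. V ** matrix_inv (?H s) ** ?U) z"
    by (intro mat_analytic_at_mult mat_analytic_at_const mat_analytic_at_matrix_inv[OF H iH])
  ultimately show ?thesis
    using K assms(1) by (simp add: projects_at_def inv_analytic_at_def)
qed

text \<open>\<open>R b = (R K) (X b)\<close>, and every derivative of \<open>R K\<close> of positive order vanishes on the column
  space of \<open>V\<close>, so only one term of the Leibniz formula survives.\<close>

lemma mat_deriv_project_left:
  assumes "projects_at K X R U V z" "mat_analytic_at b z"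
    and span: "\<And>i. i \<le> j \<Longrightarrow> \<exists>y. mat_deriv i (\<lambda>s. X s ** b s) z = V ** y"
  shows "mat_deriv j (\<lambda>s. R s ** b s) z = mat_deriv j (\<lambda>s. X s ** b s) z"
proof -
  have an: "mat_analytic_at (\<lambda>s. R s ** K s) z" "mat_analytic_at (\<lambda>s. X s ** b s) z"
    using assms by (auto simp: projects_at_def)
  \<comment> \<open>The identity \<open>K s ** X s = mat 1\<close> is inserted between the two
    factors.\<close>
  have "\<forall>\<^sub>F s in nhds z. R s ** b s = (R s ** K s) ** (X s ** b s)"
    using assms(1) unfolding projects_at_def
    by (auto elim!: eventually_mono) (metis matrix_mul_assoc matrix_mul_lid)
  then have "mat_deriv j (\<lambda>s. R s ** b s) z = mat_deriv j (\<lambda>s. (R s ** K s) ** (X s ** b s)) z"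
    by (rule mat_deriv_cong)
  also have "\<dots> = (\<Sum>i\<le>j. real (j choose i)
      *\<^sub>R (mat_deriv i (\<lambda>s. R s ** K s) z ** mat_deriv (j - i) (\<lambda>s. X s ** b s) z))"
    using an by (rule mat_deriv_mult)
  also have "\<dots> = (\<Sum>i\<le>j. if i = 0 then mat_deriv j (\<lambda>s. X s ** b s) z else 0)"
  proof (rule sum.cong[OF refl])
    fix i assume "i \<in> {..j}"
    obtain y where y: "mat_deriv (j - i) (\<lambda>s. X s ** b s) z = V ** y"
      using span[of "j - i"] by auto
    have "mat_deriv i (\<lambda>s. R s ** K s) z ** V = mat_deriv i (\<lambda>s. R s ** K s ** V) z"
      using an(1) by (simp add: mat_deriv_mult_const_right)
    also have "\<dots> = mat_deriv i (\<lambda>s. V) z"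
      using assms(1) unfolding projects_at_def by (intro mat_deriv_cong) (auto elim: eventually_mono)
    also have "\<dots> = (if i = 0 then V else 0)" by (rule mat_deriv_const)
    finally show "real (j choose i)
        *\<^sub>R (mat_deriv i (\<lambda>s. R s ** K s) z ** mat_deriv (j - i) (\<lambda>s. X s ** b s) z)
      = (if i = 0 then mat_deriv j (\<lambda>s. X s ** b s) z else 0)"
      using y by (auto simp: matrix_mul_assoc)
  qed
  finally show ?thesis by simp
qed

text \<open>The mirror image: \<open>c R = (c X) (K R)\<close>, and \<open>U (K R) = U\<close> is
  constant near \<open>z\<close>, so \<open>U\<close> annihilates the derivatives of
  \<open>K R\<close> of positive order from the left. Only the term \<open>i = j\<close> of the
  Leibniz formula survives.\<close>

lemma mat_deriv_project_right:
  assumes "projects_at K X R U V z" "mat_analytic_at c z"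
    and span: "\<And>i. i \<le> j \<Longrightarrow> \<exists>y. mat_deriv i (\<lambda>s. c s ** X s) z = y ** U"
  shows "mat_deriv j (\<lambda>s. c s ** R s) z = mat_deriv j (\<lambda>s. c s ** X s) z"
proof -
  have an: "mat_analytic_at (\<lambda>s. c s ** X s) z" "mat_analytic_at (\<lambda>s. K s ** R s) z"
    using assms by (auto simp: projects_at_def)
  have "\<forall>\<^sub>F s in nhds z. c s ** R s = (c s ** X s) ** (K s ** R s)"
    using assms(1) unfolding projects_at_def
    by (auto elim!: eventually_mono) (metis matrix_mul_assoc matrix_mul_lid)
  then have "mat_deriv j (\<lambda>s. c s ** R s) z = mat_deriv j (\<lambda>s. (c s ** X s) ** (K s ** R s)) z"
    by (rule mat_deriv_cong)
  also have "\<dots> = (\<Sum>i\<le>j. real (j choose i)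
      *\<^sub>R (mat_deriv i (\<lambda>s. c s ** X s) z ** mat_deriv (j - i) (\<lambda>s. K s ** R s) z))"
    using an by (rule mat_deriv_mult)
  also have "\<dots> = (\<Sum>i\<le>j. if i = j then mat_deriv j (\<lambda>s. c s ** X s) z else 0)"
  proof (rule sum.cong[OF refl])
    fix i assume i: "i \<in> {..j}"
    obtain y where y: "mat_deriv i (\<lambda>s. c s ** X s) z = y ** U"
      using span[of i] i by auto
    have "U ** mat_deriv (j - i) (\<lambda>s. K s ** R s) z = mat_deriv (j - i) (\<lambda>s. U ** (K s ** R s)) z"
      using an(2) by (simp add: mat_deriv_mult_const_left)
    also have "\<dots> = mat_deriv (j - i) (\<lambda>s. U) z"
      using assms(1) unfolding projects_at_def
      by (intro mat_deriv_cong) (auto elim!: eventually_mono simp: matrix_mul_assoc)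
    also have "\<dots> = (if i = j then U else 0)" using i by (simp add: mat_deriv_const)
    finally show "real (j choose i)
        *\<^sub>R (mat_deriv i (\<lambda>s. c s ** X s) z ** mat_deriv (j - i) (\<lambda>s. K s ** R s) z)
      = (if i = j then mat_deriv j (\<lambda>s. c s ** X s) z else 0)"
      using y by (auto simp: matrix_mul_assoc[symmetric])
  qed
  finally show ?thesis by simp
qed

section \<open>Derivatives of the transfer functions\<close>

text \<open>\<open>col_state\<close> accumulates the differentiated factors of the variables \<open>1, \<dots>, m\<close> from the right,
  \<open>row_state\<close> those of the last \<open>m\<close> variables from the left; as long as no factor has been
  accumulated, the state is the function \<open>B\<close> resp. \<open>C\<close> of the next variable.
  The arguments of \<open>p\<close> and \<open>z\<close> in \<open>row_state\<close> count the variables backwards, from \<open>0\<close>.\<close>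

fun col_state ::
  "(complex \<Rightarrow> complex^'n^'n) \<Rightarrow> (complex \<Rightarrow> complex^'n^'n) \<Rightarrow> (complex \<Rightarrow> complex^1^'n) \<Rightarrow>
   (nat \<Rightarrow> nat) \<Rightarrow> (nat \<Rightarrow> complex) \<Rightarrow> nat \<Rightarrow> complex \<Rightarrow> complex^1^'n" where
  "col_state N X B p z 0 = B"
| "col_state N X B p z (Suc m) = (\<lambda>_. mat_deriv (p (Suc m))
     (\<lambda>s. N s ** (X s ** col_state N X B p z m s)) (z (Suc m)))"

fun row_state ::
  "(complex \<Rightarrow> complex^'n^1) \<Rightarrow> (complex \<Rightarrow> complex^'n^'n) \<Rightarrow> (complex \<Rightarrow> complex^'n^'n) \<Rightarrow>
   (nat \<Rightarrow> nat) \<Rightarrow> (nat \<Rightarrow> complex) \<Rightarrow> nat \<Rightarrow> complex \<Rightarrow> complex^'n^1" where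
  "row_state C N X p z 0 = C"
| "row_state C N X p z (Suc m) =
     (\<lambda>t. mat_deriv (p m) (\<lambda>s. row_state C N X p z m s ** X s) (z m) ** N t)"

text \<open>A state reads only the orders and points of the variables already absorbed. So the order
  at the next variable may be lowered from the full one without changing the state.\<close>

lemma col_state_cong:
  assumes "\<And>i. 1 \<le> i \<Longrightarrow> i \<le> m \<Longrightarrow> p i = p' i \<and> z i = z' i"
  shows "col_state N X B p z m = col_state N X B p' z' m"
  using assms by (induction m) auto

lemma row_state_cong:
  assumes "\<And>i. i < m \<Longrightarrow> p i = p' i \<and> z i = z' i"
  shows "row_state C N X p z m = row_state C N X p' z' m"
  using assms by (induction m) auto

lemma mat_analytic_at_col_state:
  "mat_analytic_at B x \<Longrightarrow> mat_analytic_at (col_state N X B p z m) x"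
  by (cases m) auto

lemma mat_analytic_at_row_state:
  "mat_analytic_at C x \<Longrightarrow> mat_analytic_at N x \<Longrightarrow> mat_analytic_at (row_state C N X p z m) x"
  by (cases m) auto

section \<open>Both transfer functions in one nested form\<close>

text \<open>With all orders zero, \<open>col_state\<close> just evaluates the nested product.
  Keeping \<open>X\<close> abstract makes the full and the reduced transfer function instances of
  one expression; \<open>m\<close> is one less than the number of variables.\<close>

definition chain ::
  "(complex \<Rightarrow> complex^'n^1) \<Rightarrow> (complex \<Rightarrow> complex^'n^'n) \<Rightarrow> (complex \<Rightarrow> complex^'n^'n) \<Rightarrow>
   (complex \<Rightarrow> complex^1^'n) \<Rightarrow> nat \<Rightarrow> (nat \<Rightarrow> complex) \<Rightarrow> complex" where
  "chain C N X B m s =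
     (C (s (Suc m)) ** (X (s (Suc m)) ** col_state N X B (\<lambda>_. 0) s m (s (Suc m)))) $ 1 $ 1"

lemma ordered_prod_Suc_left:
  "a \<le> b \<Longrightarrow> ordered_prod A a b = A a ** ordered_prod A (Suc a) b"
  unfolding ordered_prod_def by (subst upt_conv_Cons) auto

lemma ordered_prod_empty: "b < a \<Longrightarrow> ordered_prod A a b = mat 1"
  by (simp add: ordered_prod_def)

lemma ordered_prod_shift:
  "ordered_prod A (Suc a) (Suc b) = ordered_prod (\<lambda>m. A (Suc m)) a b"
proof -
  have "[Suc a..<Suc (Suc b)] = map Suc [a..<Suc b]"
    by (simp only: map_Suc_upt)
  then show ?thesis unfolding ordered_prod_def by (simp only: foldr_map o_def)
qed

lemma ordered_prod_desc_Suc: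
  "ordered_prod (\<lambda>j. M (Suc m - j)) 1 (Suc n) = M m ** ordered_prod (\<lambda>j. M (m - j)) 1 n"
  by (simp add: ordered_prod_Suc_left ordered_prod_shift)

lemma transfer_fun_eq_chain:
  "transfer_fun C K N B (Suc m) s = chain C N (\<lambda>s. matrix_inv (K s)) B m s"
proof -
  have "ordered_prod (\<lambda>j. N (s (Suc m - j)) ** matrix_inv (K (s (Suc m - j)))) 1 m ** B (s 1)
      = col_state N (\<lambda>s. matrix_inv (K s)) B (\<lambda>_. 0) s m (s (Suc m))"
  proof (induction m)
    case (Suc m)
    show ?case
      unfolding ordered_prod_desc_Suc[of "\<lambda>i. N (s i) ** matrix_inv (K (s i))"]
      using Suc by (simp add: matrix_mul_assoc[symmetric])
  qed (simp add: ordered_prod_empty)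
  then show ?thesis
    by (simp add: transfer_fun_def chain_def matrix_mul_assoc[symmetric])
qed

text \<open>In the reduced product every inverse has \<open>V\<close> on its left and the conjugate
  transpose of \<open>W\<close> on its right, coming from the neighbouring hatted factors.
  Regrouping attaches both to the inverse and leaves the original \<open>C\<close>, \<open>N\<close>
  and \<open>B\<close>.\<close>

lemma reduced_transfer_fun_eq_chain:
  "reduced_transfer_fun W V C K N B (Suc m) s
   = chain C N (\<lambda>s. V ** matrix_inv (conj_transpose W ** K s ** V) ** conj_transpose W) B m s"
proof -
  let ?U = "conj_transpose W"
  let ?Y = "\<lambda>s. matrix_inv (?U ** K s ** V)"
  have "col_state (\<lambda>s. ?U ** N s ** V) ?Y (\<lambda>s. ?U ** B s) (\<lambda>_. 0) s m x
      = ?U ** col_state N (\<lambda>s. V ** ?Y s ** ?U) B (\<lambda>_. 0) s m x" for x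
    by (induction m arbitrary: x) (simp_all add: matrix_mul_assoc[symmetric])
  then show ?thesis
    by (simp add: reduced_transfer_fun_def transfer_fun_eq_chain chain_def matrix_mul_assoc[symmetric])
qed

section \<open>Mixed partial derivatives of chains\<close>

text \<open>The step in the recursion of \<open>mixed_partial\<close> only determines the partial derivative where
  the remaining variables are unchanged, hence the restriction on \<open>y\<close>.\<close>

lemma mixed_partial_cong:
  assumes "\<And>y. (\<And>m. m > k \<Longrightarrow> y m = z m) \<Longrightarrow> f y = g y"
  shows "mixed_partial k p f z = mixed_partial k p g z"
  using assms
proof (induction k arbitrary: f g)
  case (Suc k)
  have "partial (Suc k) (p (Suc k)) f y = partial (Suc k) (p (Suc k)) g y"
    if y: "\<And>m. m > k \<Longrightarrow> y m = z m" for y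
  proof -
    have "(\<lambda>t. f (y(Suc k := t))) = (\<lambda>t. g (y(Suc k := t)))"
      by (rule ext, rule Suc.prems) (use y in auto)
    then show ?thesis by (simp add: partial_def)
  qed
  then show ?case unfolding mixed_partial.simps by (rule Suc.IH)
qed simp

text \<open>The last variable occurs only in the leading factor \<open>C X\<close>. Its derivative
  there is a constant row, which together with the following \<open>N\<close> takes the place of
  \<open>C\<close> in a chain with one variable less.\<close>

lemma mixed_partial_chain_Suc:
  assumes "mat_analytic_at C (z (Suc (Suc m)))" "mat_analytic_at X (z (Suc (Suc m)))"
  shows "mixed_partial (Suc (Suc m)) p (chain C N X B (Suc m)) z
    = mixed_partial (Suc m) p
        (chain (\<lambda>t. mat_deriv (p (Suc (Suc m))) (\<lambda>s. C s ** X s) (z (Suc (Suc m))) ** N t) N X B m) z"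
proof -
  let ?k = "Suc (Suc m)"
  let ?D = "mat_deriv (p ?k) (\<lambda>s. C s ** X s) (z ?k)"
  have "partial ?k (p ?k) (chain C N X B (Suc m)) y = chain (\<lambda>t. ?D ** N t) N X B m y"
    if "\<And>i. i > Suc m \<Longrightarrow> y i = z i" for y
  proof -
    \<comment> \<open>All factors that belong to the earlier variables, a constant for the
      derivative in the last one.\<close>
    define c where "c = N (y (Suc m)) ** (X (y (Suc m)) ** col_state N X B (\<lambda>_. 0) y m (y (Suc m)))"
    have yk: "y ?k = z ?k" using that by simp
    have "col_state N X B (\<lambda>_. 0) (y(?k := t)) m = col_state N X B (\<lambda>_. 0) y m" for t
      by (rule col_state_cong) auto
    then have "chain C N X B (Suc m) (y(?k := t)) = (C t ** X t ** c) $ 1 $ 1" for t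
      by (simp add: chain_def c_def matrix_mul_assoc)
    then have "partial ?k (p ?k) (chain C N X B (Suc m)) y
        = mat_deriv (p ?k) (\<lambda>t. C t ** X t ** c) (z ?k) $ 1 $ 1"
      by (simp add: partial_def mat_deriv_def yk)
    also have "\<dots> = (?D ** c) $ 1 $ 1"
      using assms by (subst mat_deriv_mult_const_right) auto
    also have "\<dots> = chain (\<lambda>t. ?D ** N t) N X B m y"
      by (simp add: chain_def c_def matrix_mul_assoc)
    finally show ?thesis .
  qed
  then show ?thesis
    unfolding mixed_partial.simps(2)[of "Suc m"] by (rule mixed_partial_cong)
qed

text \<open>Iterates the removal of the last variable \<open>n\<close> times. The reflection
  \<open>Suc m - i\<close> is there because \<open>row_state\<close> counts from the last variable
  down.\<close>

lemma mixed_partial_chain_split: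
  assumes "n \<le> m"
    and "\<And>i. 1 \<le> i \<Longrightarrow> i \<le> Suc m \<Longrightarrow>
      mat_analytic_at C (z i) \<and> mat_analytic_at N (z i) \<and> mat_analytic_at X (z i)"
  shows "mixed_partial (Suc m) p (chain C N X B m) z
    = mixed_partial (Suc (m - n)) p (chain (row_state C N X (\<lambda>i. p (Suc m - i))
        (\<lambda>i. z (Suc m - i)) n) N X B (m - n)) z"
  using assms(1)
proof (induction n)
  case (Suc n)
  let ?r = "row_state C N X (\<lambda>i. p (Suc m - i)) (\<lambda>i. z (Suc m - i))"
  have eq: "m - n = Suc (m - Suc n)" "Suc m - n = Suc (Suc (m - Suc n))"
    using Suc.prems by (simp_all add: Suc_diff_Suc Suc_diff_le)
  have an: "mat_analytic_at (?r n) (z (Suc (Suc (m - Suc n))))"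
    "mat_analytic_at X (z (Suc (Suc (m - Suc n))))"
    using assms(2)[of "Suc (Suc (m - Suc n))"] Suc.prems by (auto intro: mat_analytic_at_row_state)
  have row: "?r (Suc n) = (\<lambda>t. mat_deriv (p (Suc (Suc (m - Suc n)))) (\<lambda>s. ?r n s ** X s)
      (z (Suc (Suc (m - Suc n)))) ** N t)"
    by (simp only: row_state.simps eq(2))
  have "mixed_partial (Suc m) p (chain C N X B m) z
      = mixed_partial (Suc (m - n)) p (chain (?r n) N X B (m - n)) z"
    using Suc by simp
  also have "\<dots> = mixed_partial (Suc (m - Suc n)) p (chain (?r (Suc n)) N X B (m - Suc n)) z"
    unfolding eq(1) row using an by (rule mixed_partial_chain_Suc)
  finally show ?case .
qed simp

text \<open>After the last variable is removed, the constant row \<open>?D\<close> can be pulled out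
  of the remaining derivative, which turns into the next column state. The induction varies
  \<open>C\<close>, since each removal replaces it.\<close>

lemma mixed_partial_chain:
  assumes "mat_analytic_at C (z (Suc m))"
    and "\<And>i. 1 \<le> i \<Longrightarrow> i \<le> Suc m \<Longrightarrow>
      mat_analytic_at N (z i) \<and> mat_analytic_at X (z i) \<and> mat_analytic_at B (z i)"
  shows "mixed_partial (Suc m) p (chain C N X B m) z
    = mat_deriv (p (Suc m)) (\<lambda>s. C s ** (X s ** col_state N X B p z m s)) (z (Suc m)) $ 1 $ 1"
  using assms
proof (induction m arbitrary: C)
  case 0
  then show ?case by (simp add: partial_def chain_def mat_deriv_def)
next
  case (Suc m)
  let ?k = "Suc (Suc m)"
  let ?D = "mat_deriv (p ?k) (\<lambda>s. C s ** X s) (z ?k)"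
  have an: "mat_analytic_at N (z (Suc m))" "mat_analytic_at X (z (Suc m))"
    "mat_analytic_at B (z (Suc m))" "mat_analytic_at X (z ?k)"
    using Suc.prems(2) by auto
  have "mixed_partial ?k p (chain C N X B (Suc m)) z
      = mixed_partial (Suc m) p (chain (\<lambda>t. ?D ** N t) N X B m) z"
    using Suc.prems(1) an by (simp only: mixed_partial_chain_Suc)
  also have "\<dots> = mat_deriv (p (Suc m))
      (\<lambda>s. ?D ** N s ** (X s ** col_state N X B p z m s)) (z (Suc m)) $ 1 $ 1"
    using Suc.prems(2) an by (intro Suc.IH) auto
  also have "\<dots> = (?D ** col_state N X B p z (Suc m) (z ?k)) $ 1 $ 1"
    using an mat_analytic_at_col_state[OF an(3)]
    by (simp add: matrix_mul_assoc[symmetric] mat_deriv_mult_const_left mat_analytic_at_mult)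
  also have "?D ** col_state N X B p z (Suc m) (z ?k)
      = mat_deriv (p ?k) (\<lambda>s. C s ** X s ** col_state N X B p z (Suc m) (z ?k)) (z ?k)"
    using Suc.prems(1) an by (subst mat_deriv_mult_const_right) auto
  finally show ?case by (simp add: matrix_mul_assoc)
qed

text \<open>The last \<open>n\<close> variables are absorbed from the left and the first
  \<open>m - n\<close> from the right; the two states meet at variable \<open>Suc (m - n)\<close>,
  the only one still under a derivative.\<close>

lemma mixed_partial_chain_row:
  assumes "n \<le> m"
    and an: "\<And>i. 1 \<le> i \<Longrightarrow> i \<le> Suc m \<Longrightarrow> mat_analytic_at C (z i) \<and> mat_analytic_at N (z i)
      \<and> mat_analytic_at X (z i) \<and> mat_analytic_at B (z i)"
  shows "mixed_partial (Suc m) p (chain C N X B m) z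
    = mat_deriv (p (Suc (m - n)))
        (\<lambda>s. row_state C N X (\<lambda>i. p (Suc m - i)) (\<lambda>i. z (Suc m - i)) n s
          ** (X s ** col_state N X B p z (m - n) s)) (z (Suc (m - n))) $ 1 $ 1"
proof -
  have "mat_analytic_at (row_state C N X (\<lambda>i. p (Suc m - i)) (\<lambda>i. z (Suc m - i)) n) (z (Suc (m - n)))"
    using an[of "Suc (m - n)"] by (intro mat_analytic_at_row_state) auto
  moreover have "mixed_partial (Suc m) p (chain C N X B m) z
    = mixed_partial (Suc (m - n)) p (chain (row_state C N X (\<lambda>i. p (Suc m - i))
        (\<lambda>i. z (Suc m - i)) n) N X B (m - n)) z"
    using assms by (intro mixed_partial_chain_split) auto
  ultimately show ?thesis using an by (simp only:) (rule mixed_partial_chain; auto)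
qed

section \<open>The interpolation vectors in terms of states\<close>

text \<open>A nonempty state is a constant, so it leaves the next derivative as a right factor. This
  produces the products in the vectors \<open>v\<close>.\<close>

lemma col_state_eq_ordered_prod:
  assumes "\<And>i. 1 \<le> i \<Longrightarrow> i \<le> Suc n \<Longrightarrow> mat_analytic_at N (z i) \<and> mat_analytic_at X (z i)"
  shows "col_state N X B p z (Suc n) t
    = ordered_prod (\<lambda>j. mat_deriv (p (Suc (Suc n) - j)) (\<lambda>s. N s ** X s) (z (Suc (Suc n) - j))) 1 n
        ** mat_deriv (p 1) (\<lambda>s. N s ** X s ** B s) (z 1)"
  using assms
proof (induction n arbitrary: t)
  case 0
  then show ?case by (simp add: ordered_prod_empty matrix_mul_assoc)
next
  case (Suc n)
  \<comment> \<open>The state is a constant function here, so evaluating it at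
    \<open>undefined\<close> gives its value everywhere.\<close>
  define c where "c = col_state N X B p z (Suc n) undefined"
  have c: "col_state N X B p z (Suc n) = (\<lambda>_. c)" by (simp add: c_def)
  have "col_state N X B p z (Suc (Suc n)) t
      = mat_deriv (p (Suc (Suc n))) (\<lambda>s. N s ** X s ** c) (z (Suc (Suc n)))"
    unfolding col_state.simps(2)[of _ _ _ _ _ "Suc n"] c by (simp add: matrix_mul_assoc)
  also have "\<dots> = mat_deriv (p (Suc (Suc n))) (\<lambda>s. N s ** X s) (z (Suc (Suc n))) ** c"
    using Suc.prems by (intro mat_deriv_mult_const_right) auto
  also have "c = ordered_prod (\<lambda>j. mat_deriv (p (Suc (Suc n) - j)) (\<lambda>s. N s ** X s)
      (z (Suc (Suc n) - j))) 1 n ** mat_deriv (p 1) (\<lambda>s. N s ** X s ** B s) (z 1)"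
    unfolding c_def using Suc by (intro Suc.IH) auto
  finally show ?case
    unfolding ordered_prod_desc_Suc[of "\<lambda>i. mat_deriv (p i) (\<lambda>s. N s ** X s) (z i)"]
    by (simp add: matrix_mul_assoc)
qed

lemma conj_transpose_mult: "conj_transpose (A ** B) = conj_transpose B ** conj_transpose A"
  by (simp add: conj_transpose_def transpose_def map_matrix_def matrix_matrix_mult_def vec_eq_iff
      mult.commute)

lemma conj_transpose_conj_transpose [simp]: "conj_transpose (conj_transpose A) = A"
  by (simp add: conj_transpose_def transpose_def map_matrix_def vec_eq_iff)

text \<open>The dual for the vectors \<open>w\<close>. These are built from conjugate transposes,
  which reverse products, so the row state is the conjugate transpose of such a product, followed by
  the factor \<open>N\<close> of the next variable.\<close>

lemma row_state_eq_ordered_prod: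
  assumes "\<And>i. 1 \<le> i \<Longrightarrow> i \<le> k \<Longrightarrow> mat_analytic_at N (z i) \<and> mat_analytic_at X (z i)"
    and "n < k"
  shows "row_state C N X (\<lambda>i. p (k - i)) (\<lambda>i. z (k - i)) (Suc n) t
    = conj_transpose (ordered_prod (\<lambda>m. conj_transpose (mat_deriv (p m) (\<lambda>s. N s ** X s) (z m)))
          (k - n) (k - 1) ** conj_transpose (mat_deriv (p k) (\<lambda>s. C s ** X s) (z k))) ** N t"
  using assms(2)
proof (induction n arbitrary: t)
  case 0
  then show ?case by (simp add: ordered_prod_empty)
next
  case (Suc n)
  let ?M = "\<lambda>m. conj_transpose (mat_deriv (p m) (\<lambda>s. N s ** X s) (z m))"
  define c where "c = conj_transpose (ordered_prod ?M (k - n) (k - 1)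
      ** conj_transpose (mat_deriv (p k) (\<lambda>s. C s ** X s) (z k)))"
  have c: "row_state C N X (\<lambda>i. p (k - i)) (\<lambda>i. z (k - i)) (Suc n) s = c ** N s" for s
    unfolding c_def using Suc by auto
  have "row_state C N X (\<lambda>i. p (k - i)) (\<lambda>i. z (k - i)) (Suc (Suc n)) t
     = mat_deriv (p (k - Suc n)) (\<lambda>s. c ** (N s ** X s)) (z (k - Suc n)) ** N t"
    unfolding row_state.simps(2)[of _ _ _ _ _ "Suc n"] c by (simp add: matrix_mul_assoc)
  also have "\<dots> = c ** mat_deriv (p (k - Suc n)) (\<lambda>s. N s ** X s) (z (k - Suc n)) ** N t"
    using Suc.prems assms(1)[of "k - Suc n"] by (subst mat_deriv_mult_const_left) auto
  also have "c ** mat_deriv (p (k - Suc n)) (\<lambda>s. N s ** X s) (z (k - Suc n))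
    = conj_transpose (?M (k - Suc n) ** conj_transpose c)"
    by (simp add: conj_transpose_mult)
  also have "?M (k - Suc n) ** conj_transpose c = ordered_prod ?M (k - Suc n) (k - 1)
      ** conj_transpose (mat_deriv (p k) (\<lambda>s. C s ** X s) (z k))"
    using Suc.prems Suc_diff_Suc[of n k]
    by (simp add: c_def ordered_prod_Suc_left[of "k - Suc n"] matrix_mul_assoc)
  finally show ?case .
qed

section \<open>Interpolation\<close>

lemma column_eq_mult_axis: "column i (A :: complex^'n^'m) = A *v axis i 1"
  by (simp add: matrix_vector_mult_def axis_def column_def vec_eq_iff if_distrib[of "(*) _"]
      cong: if_cong)

text \<open>Turns membership in the column space into a factorization through \<open>V\<close>, the
  form in which the projection lemmas take it.\<close>

lemma column_in_span_imp_mult: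
  fixes x :: "complex^1^'n" and V :: "complex^'r^'n"
  assumes "column 1 x \<in> vec.span (columns V)"
  shows "\<exists>y :: complex^1^'r. x = V ** y"
proof -
  have "\<exists>u. x = V *v u" if "x \<in> vec.span (columns V)" for x
    using that
  proof (induction rule: vec.span_induct_alt)
    case base
    then show ?case by (metis matrix_vector_mult_0_right)
  next
    case (step c a b)
    then obtain i u where "a = column i V" "b = V *v u" by (auto simp: columns_def)
    then have "c *s a + b = V *v (c *s axis i 1 + u)"
      by (simp add: matrix_vector_right_distrib vector_scalar_commute column_eq_mult_axis)
    then show ?case by blast
  qed
  then obtain u where u: "column 1 x = V *v u" using assms by auto
  have "x = V ** (\<chi> i j. u $ i)"
    using u unfolding vec_eq_iff
    by (simp add: column_def matrix_vector_mult_def matrix_matrix_mult_def forall_1)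
  then show ?thesis by blast
qed

text \<open>Induction over the variables: once the states for \<open>R\<close> and \<open>X\<close>
  agree, the span condition, stated for \<open>X\<close> alone, allows projection at the next
  variable. The Leibniz rule then carries the equality through the factor \<open>N\<close>.\<close>

lemma col_state_project:
  assumes "\<And>i. 1 \<le> i \<Longrightarrow> i \<le> k \<Longrightarrow> projects_at K X R U V (z i) \<and> mat_analytic_at N (z i)
      \<and> mat_analytic_at B (z i)"
    and "\<And>q j. q < k \<Longrightarrow> j \<le> p (Suc q) \<Longrightarrow>
      \<exists>y. mat_deriv j (\<lambda>s. X s ** col_state N X B p z q s) (z (Suc q)) = V ** y"
  shows "m \<le> k \<Longrightarrow> col_state N R B p z m = col_state N X B p z m"
    and "m < k \<Longrightarrow> j \<le> p (Suc m) \<Longrightarrow>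
      mat_deriv j (\<lambda>s. R s ** col_state N R B p z m s) (z (Suc m))
      = mat_deriv j (\<lambda>s. X s ** col_state N X B p z m s) (z (Suc m))"
proof -
  have an: "mat_analytic_at (\<lambda>s. Y s ** col_state N X B p z m s) (z (Suc m))"
    if "m < k" "Y = X \<or> Y = R" for m Y
    using assms(1)[of "Suc m"] that
    by (auto intro!: mat_analytic_at_col_state simp: projects_at_def)
  \<comment> \<open>Here \<open>R\<close> multiplies the state formed with \<open>X\<close>; the
    states themselves are identified afterwards by induction.\<close>
  have step: "mat_deriv j (\<lambda>s. R s ** col_state N X B p z m s) (z (Suc m))
      = mat_deriv j (\<lambda>s. X s ** col_state N X B p z m s) (z (Suc m))"
    if "m < k" "j \<le> p (Suc m)" for m j
    using assms(1)[of "Suc m"] that assms(2)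
    by (intro mat_deriv_project_left[where K = K and U = U and V = V])
      (auto intro: mat_analytic_at_col_state)
  have eq: "m \<le> k \<Longrightarrow> col_state N R B p z m = col_state N X B p z m" for m
  proof (induction m)
    case (Suc m)
    then have IH: "col_state N R B p z m = col_state N X B p z m" by simp
    have "mat_deriv (p (Suc m)) (\<lambda>s. N s ** (R s ** col_state N X B p z m s)) (z (Suc m))
        = mat_deriv (p (Suc m)) (\<lambda>s. N s ** (X s ** col_state N X B p z m s)) (z (Suc m))"
      using assms(1)[of "Suc m"] Suc.prems an step by (intro mat_deriv_mult_cong[OF _ _ _ _ refl]) auto
    then show ?case by (simp add: IH)
  qed simp
  show "m \<le> k \<Longrightarrow> col_state N R B p z m = col_state N X B p z m" by (rule eq)
  show "m < k \<Longrightarrow> j \<le> p (Suc m) \<Longrightarrow>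
      mat_deriv j (\<lambda>s. R s ** col_state N R B p z m s) (z (Suc m))
      = mat_deriv j (\<lambda>s. X s ** col_state N X B p z m s) (z (Suc m))"
    using step eq by simp
qed

text \<open>The same induction from the left. In a row state \<open>N\<close> stands outside the
  derivative, so equal derivatives give equal states at once.\<close>

lemma row_state_project:
  assumes "\<And>i. i < k \<Longrightarrow> projects_at K X R U V (z i) \<and> mat_analytic_at N (z i)
      \<and> mat_analytic_at C (z i)"
    and "\<And>n j. n < k \<Longrightarrow> j \<le> p n \<Longrightarrow>
      \<exists>y. mat_deriv j (\<lambda>s. row_state C N X p z n s ** X s) (z n) = y ** U"
  shows "m \<le> k \<Longrightarrow> row_state C N R p z m = row_state C N X p z m"
    and "m < k \<Longrightarrow> j \<le> p m \<Longrightarrow> mat_deriv j (\<lambda>s. row_state C N R p z m s ** R s) (z m)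
      = mat_deriv j (\<lambda>s. row_state C N X p z m s ** X s) (z m)"
proof -
  have step: "mat_deriv j (\<lambda>s. row_state C N X p z m s ** R s) (z m)
      = mat_deriv j (\<lambda>s. row_state C N X p z m s ** X s) (z m)"
    if "m < k" "j \<le> p m" for m j
    using assms(1)[of m] that assms(2)
    by (intro mat_deriv_project_right[where K = K and U = U and V = V])
      (auto intro: mat_analytic_at_row_state)
  have eq: "m \<le> k \<Longrightarrow> row_state C N R p z m = row_state C N X p z m" for m
    by (induction m) (auto simp: step)
  show "m \<le> k \<Longrightarrow> row_state C N R p z m = row_state C N X p z m" by (rule eq)
  show "m < k \<Longrightarrow> j \<le> p m \<Longrightarrow> mat_deriv j (\<lambda>s. row_state C N R p z m s ** R s) (z m)
      = mat_deriv j (\<lambda>s. row_state C N X p z m s ** X s) (z m)"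
    using step eq by simp
qed

section \<open>The interpolation conditions\<close>

theorem theorem7:
  fixes C :: "complex \<Rightarrow> complex^'n^1"
    and K N :: "complex \<Rightarrow> complex^'n^'n"
    and B :: "complex \<Rightarrow> complex^1^'n"
    and W V :: "complex^'r^'n"
    and k \<theta> :: nat
    and \<sigma> \<tau> :: "nat \<Rightarrow> complex"
    and l \<nu> :: "nat \<Rightarrow> nat"
    and v w :: "nat \<Rightarrow> nat \<Rightarrow> complex^1^'n"
  defines "G \<equiv> transfer_fun C K N B"
    and "G_red \<equiv> reduced_transfer_fun W V C K N B"
  assumes "k \<ge> 1" and "\<theta> \<ge> 1"
    and "\<And>q. 1 \<le> q \<Longrightarrow> q \<le> k \<Longrightarrow> admissible_point W V C K N B (\<sigma> q)"
    and "\<And>\<eta>. 1 \<le> \<eta> \<Longrightarrow> \<eta> \<le> \<theta> \<Longrightarrow> admissible_point W V C K N B (\<tau> \<eta>)"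
    and "\<And>j. j \<le> l 1 \<Longrightarrow> v 1 j = mat_deriv j (\<lambda>s. matrix_inv (K s) ** B s) (\<sigma> 1)"
    and "\<And>q j. 2 \<le> q \<Longrightarrow> q \<le> k \<Longrightarrow> j \<le> l q \<Longrightarrow>
      v q j = mat_deriv j (\<lambda>s. matrix_inv (K s)) (\<sigma> q)
        ** ordered_prod (\<lambda>m. mat_deriv (l (q - m)) (\<lambda>s. N s ** matrix_inv (K s)) (\<sigma> (q - m)))
             1 (q - 2)
        ** mat_deriv (l 1) (\<lambda>s. N s ** matrix_inv (K s) ** B s) (\<sigma> 1)"
    and "\<And>q j. 1 \<le> q \<Longrightarrow> q \<le> k \<Longrightarrow> j \<le> l q \<Longrightarrow> column 1 (v q j) \<in> vec.span (columns V)"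
    and "\<And>i. i \<le> \<nu> \<theta> \<Longrightarrow>
      w 1 i = conj_transpose (mat_deriv i (\<lambda>s. C s ** matrix_inv (K s)) (\<tau> \<theta>))"
    and "\<And>\<eta> i. 2 \<le> \<eta> \<Longrightarrow> \<eta> \<le> \<theta> \<Longrightarrow> i \<le> \<nu> (\<theta> - \<eta> + 1) \<Longrightarrow>
      w \<eta> i = conj_transpose (mat_deriv i (\<lambda>s. N s ** matrix_inv (K s)) (\<tau> (\<theta> - \<eta> + 1)))
        ** ordered_prod (\<lambda>m. conj_transpose (mat_deriv (\<nu> m) (\<lambda>s. N s ** matrix_inv (K s)) (\<tau> m)))
             (\<theta> - \<eta> + 2) (\<theta> - 1)
        ** conj_transpose (mat_deriv (\<nu> \<theta>) (\<lambda>s. C s ** matrix_inv (K s)) (\<tau> \<theta>))"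
    and "\<And>\<eta> i. 1 \<le> \<eta> \<Longrightarrow> \<eta> \<le> \<theta> \<Longrightarrow> i \<le> \<nu> (\<theta> - \<eta> + 1) \<Longrightarrow>
      column 1 (w \<eta> i) \<in> vec.span (columns W)"
  shows "(\<forall>q j. 1 \<le> q \<and> q \<le> k \<and> j \<le> l q \<longrightarrow>
      mixed_partial q (l(q := j)) (G q) \<sigma> = mixed_partial q (l(q := j)) (G_red q) \<sigma>)
    \<and> (\<forall>\<eta> i. 1 \<le> \<eta> \<and> \<eta> \<le> \<theta> \<and> i \<le> \<nu> (\<theta> - \<eta> + 1) \<longrightarrow>
      mixed_partial \<eta> ((\<lambda>m. \<nu> (\<theta> - \<eta> + m))(1 := i)) (G \<eta>) (\<lambda>m. \<tau> (\<theta> - \<eta> + m))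
      = mixed_partial \<eta> ((\<lambda>m. \<nu> (\<theta> - \<eta> + m))(1 := i)) (G_red \<eta>) (\<lambda>m. \<tau> (\<theta> - \<eta> + m)))
    \<and> (\<forall>q \<eta> j i. 1 \<le> q \<and> q \<le> k \<and> 1 \<le> \<eta> \<and> \<eta> \<le> \<theta> \<and> j \<le> l q \<and> i \<le> \<nu> (\<theta> - \<eta> + 1) \<longrightarrow>
      mixed_partial (q + \<eta>) (splice_at q (l(q := j)) ((\<lambda>m. \<nu> (\<theta> - \<eta> + m))(1 := i)))
        (G (q + \<eta>)) (splice_at q \<sigma> (\<lambda>m. \<tau> (\<theta> - \<eta> + m)))
      = mixed_partial (q + \<eta>) (splice_at q (l(q := j)) ((\<lambda>m. \<nu> (\<theta> - \<eta> + m))(1 := i)))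
        (G_red (q + \<eta>)) (splice_at q \<sigma> (\<lambda>m. \<tau> (\<theta> - \<eta> + m))))"
proof -
  define X where "X = (\<lambda>s. matrix_inv (K s))"
  define U where "U = conj_transpose W"
  define R where "R = (\<lambda>s. V ** matrix_inv (U ** K s ** V) ** U)"
  define cs where "cs = (\<lambda>Y. col_state N Y B l \<sigma>)"
  \<comment> \<open>Index \<open>i\<close> of the row state refers to the point
    \<open>\<tau> (\<theta> - i)\<close>, so that \<open>0\<close> is the last point.\<close>
  define rs where "rs = (\<lambda>Y. row_state C N Y (\<lambda>i. \<nu> (\<theta> - i)) (\<lambda>i. \<tau> (\<theta> - i)))"

  have G: "G (Suc m) = chain C N X B m" for m
    by (rule ext) (simp add: assms(1) X_def transfer_fun_eq_chain)
  have G_red: "G_red (Suc m) = chain C N R B m" for m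
    by (rule ext) (simp add: assms(2) R_def U_def reduced_transfer_fun_eq_chain)

  have adm: "projects_at K X R U V z \<and> mat_analytic_at C z \<and> mat_analytic_at N z
      \<and> mat_analytic_at B z" if "admissible_point W V C K N B z" for z
    using that projects_atI[of K z W V] by (simp add: admissible_point_def X_def R_def U_def)
  have \<sigma>: "projects_at K X R U V (\<sigma> q)" "mat_analytic_at C (\<sigma> q)" "mat_analytic_at N (\<sigma> q)"
    "mat_analytic_at B (\<sigma> q)" "mat_analytic_at X (\<sigma> q)" "mat_analytic_at R (\<sigma> q)"
    if "1 \<le> q" "q \<le> k" for q
    using adm[OF assms(5)[OF that]] by (auto simp: projects_at_def)
  have \<tau>: "projects_at K X R U V (\<tau> q)" "mat_analytic_at C (\<tau> q)" "mat_analytic_at N (\<tau> q)"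
    "mat_analytic_at B (\<tau> q)" "mat_analytic_at X (\<tau> q)" "mat_analytic_at R (\<tau> q)"
    if "1 \<le> q" "q \<le> \<theta>" for q
    using adm[OF assms(6)[OF that]] by (auto simp: projects_at_def)

  \<comment> \<open>The given vectors are exactly the derivatives to which the projection from the
    left will be applied.\<close>
  have v: "v (Suc q) j = mat_deriv j (\<lambda>s. X s ** cs X q s) (\<sigma> (Suc q))"
    if "q < k" "j \<le> l (Suc q)" for q j
  proof (cases q)
    case 0
    then show ?thesis using assms(7) that by (simp add: cs_def X_def)
  next
    case (Suc n)
    define c where "c
      = ordered_prod (\<lambda>i. mat_deriv (l (Suc (Suc n) - i)) (\<lambda>s. N s ** X s) (\<sigma> (Suc (Suc n) - i))) 1 n
        ** mat_deriv (l 1) (\<lambda>s. N s ** X s ** B s) (\<sigma> 1)"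
    have "cs X (Suc n) s = c" for s
      unfolding cs_def c_def using \<sigma> that Suc by (intro col_state_eq_ordered_prod) auto
    then have "mat_deriv j (\<lambda>s. X s ** cs X q s) (\<sigma> (Suc q)) = mat_deriv j X (\<sigma> (Suc q)) ** c"
      using that Suc \<sigma>(5)[of "Suc q"] by (simp add: mat_deriv_mult_const_right)
    then show ?thesis
      using assms(8)[of "Suc q" j] that Suc by (simp add: c_def X_def matrix_mul_assoc)
  qed
  have colV: "\<exists>y. mat_deriv j (\<lambda>s. X s ** cs X q s) (\<sigma> (Suc q)) = V ** y"
    if "q < k" "j \<le> l (Suc q)" for q j
    using column_in_span_imp_mult[OF assms(9)[of "Suc q" j]] v that by auto

  have w: "conj_transpose (w (Suc n) j) = mat_deriv j (\<lambda>s. rs X n s ** X s) (\<tau> (\<theta> - n))"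
    if "n < \<theta>" "j \<le> \<nu> (\<theta> - n)" for n j
  proof (cases n)
    case 0
    then show ?thesis using assms(10) that by (simp add: rs_def X_def)
  next
    case (Suc m)
    define c where "c = conj_transpose (ordered_prod
        (\<lambda>m. conj_transpose (mat_deriv (\<nu> m) (\<lambda>s. N s ** X s) (\<tau> m))) (\<theta> - m) (\<theta> - 1)
        ** conj_transpose (mat_deriv (\<nu> \<theta>) (\<lambda>s. C s ** X s) (\<tau> \<theta>)))"
    have "rs X (Suc m) s = c ** N s" for s
      unfolding rs_def c_def using \<tau> that Suc by (intro row_state_eq_ordered_prod) auto
    then have "mat_deriv j (\<lambda>s. rs X n s ** X s) (\<tau> (\<theta> - n))
        = c ** mat_deriv j (\<lambda>s. N s ** X s) (\<tau> (\<theta> - n))"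
      using \<tau>(3,5)[of "\<theta> - n"] that Suc
      by (simp add: matrix_mul_assoc[symmetric] mat_deriv_mult_const_left mat_analytic_at_mult)
    moreover have "\<theta> - Suc n + 1 = \<theta> - n" "\<theta> - Suc n + 2 = \<theta> - m"
      using that Suc by auto
    ultimately show ?thesis
      using assms(11)[of "Suc n" j] that Suc
      by (simp add: c_def X_def conj_transpose_mult matrix_mul_assoc)
  qed
  have rowU: "\<exists>y. mat_deriv j (\<lambda>s. rs X n s ** X s) (\<tau> (\<theta> - n)) = y ** U"
    if nj: "n < \<theta>" "j \<le> \<nu> (\<theta> - n)" for n j
  proof -
    have "\<theta> - Suc n + 1 = \<theta> - n" using nj by auto
    then obtain y where "w (Suc n) j = W ** y"
      using column_in_span_imp_mult[OF assms(12)[of "Suc n" j]] nj by auto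
    then have "mat_deriv j (\<lambda>s. rs X n s ** X s) (\<tau> (\<theta> - n)) = conj_transpose y ** U"
      using w[OF nj, symmetric] by (simp add: conj_transpose_mult U_def)
    then show ?thesis by blast
  qed

  have col: "mat_deriv j (\<lambda>s. R s ** cs R q s) (\<sigma> (Suc q))
      = mat_deriv j (\<lambda>s. X s ** cs X q s) (\<sigma> (Suc q))"
    if "q < k" "j \<le> l (Suc q)" for q j
    unfolding cs_def
    by (rule col_state_project(2)[where K = K and U = U and V = V and k = k])
      (use \<sigma> colV that in \<open>auto simp: cs_def\<close>)
  have row: "mat_deriv j (\<lambda>s. rs R n s ** R s) (\<tau> (\<theta> - n))
      = mat_deriv j (\<lambda>s. rs X n s ** X s) (\<tau> (\<theta> - n))"
    if "n < \<theta>" "j \<le> \<nu> (\<theta> - n)" for n j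
    unfolding rs_def
    by (rule row_state_project(2)[where K = K and U = U and V = V and k = \<theta>])
      (use \<tau> rowU that in \<open>auto simp: rs_def\<close>)

  have an_cs: "mat_analytic_at (cs Y q) (\<sigma> (Suc q))" if "q < k" for Y q
    unfolding cs_def using \<sigma>(4) that by (intro mat_analytic_at_col_state) auto
  have an_rs: "mat_analytic_at (rs Y n) (\<tau> (\<theta> - n))" if "n < \<theta>" for Y n
    unfolding rs_def using \<tau>(2,3) that by (intro mat_analytic_at_row_state) auto
  \<comment> \<open>The row factor \<open>\<alpha>\<close> is left free: it is \<open>C\<close> in
    the first claim and the absorbed left part of the chain in the mixed claim.\<close>
  have left: "mat_deriv j (\<lambda>s. \<alpha> s ** (X s ** cs X q s)) (\<sigma> (Suc q))
      = mat_deriv j (\<lambda>s. \<alpha> s ** (R s ** cs R q s)) (\<sigma> (Suc q))"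
    if "mat_analytic_at \<alpha> (\<sigma> (Suc q))" "q < k" "j \<le> l (Suc q)" 
    for \<alpha> :: "complex \<Rightarrow> complex^'n^1" and q j
    by (rule mat_deriv_mult_cong) (use that \<sigma>(5,6) an_cs col in auto)
  have right: "mat_deriv i (\<lambda>s. rs X n s ** X s ** B s) (\<tau> (\<theta> - n))
      = mat_deriv i (\<lambda>s. rs R n s ** R s ** B s) (\<tau> (\<theta> - n))"
    if "n < \<theta>" "i \<le> \<nu> (\<theta> - n)" for n i
    by (rule mat_deriv_mult_cong) (use that \<tau>(4,5,6) an_rs row in auto)

  have 1: "mixed_partial q (l(q := j)) (G q) \<sigma> = mixed_partial q (l(q := j)) (G_red q) \<sigma>"
    if q: "1 \<le> q" "q \<le> k" and j: "j \<le> l q" for q j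
  proof -
    obtain m where m: "q = Suc m" using q by (cases q) auto
    have "mixed_partial q (l(q := j)) (chain C N Y B m) \<sigma>
        = mat_deriv j (\<lambda>s. C s ** (Y s ** cs Y m s)) (\<sigma> (Suc m)) $ 1 $ 1"
      if "Y = X \<or> Y = R" for Y
    proof -
      have "col_state N Y B (l(q := j)) \<sigma> m = cs Y m"
        unfolding cs_def by (rule col_state_cong) (use m in auto)
      then show ?thesis
        using mixed_partial_chain[of C \<sigma> m N Y B "l(q := j)"] \<sigma> q that m by auto
    qed
    then show ?thesis
      using left[of C m j] \<sigma>(2) q j m by (simp add: G G_red)
  qed

  have 2: "mixed_partial \<eta> ((\<lambda>m. \<nu> (\<theta> - \<eta> + m))(1 := i)) (G \<eta>) (\<lambda>m. \<tau> (\<theta> - \<eta> + m))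
      = mixed_partial \<eta> ((\<lambda>m. \<nu> (\<theta> - \<eta> + m))(1 := i)) (G_red \<eta>) (\<lambda>m. \<tau> (\<theta> - \<eta> + m))"
    if \<eta>: "1 \<le> \<eta>" "\<eta> \<le> \<theta>" and i: "i \<le> \<nu> (\<theta> - \<eta> + 1)" for \<eta> i
  proof -
    obtain n where n: "\<eta> = Suc n" using \<eta> by (cases \<eta>) auto
    have idx: "\<theta> - \<eta> + 1 = \<theta> - n" using \<eta> n by auto
    let ?p = "(\<lambda>m. \<nu> (\<theta> - \<eta> + m))(1 := i)" and ?z = "\<lambda>m. \<tau> (\<theta> - \<eta> + m)"
    have "mixed_partial \<eta> ?p (chain C N Y B n) ?z
        = mat_deriv i (\<lambda>s. rs Y n s ** Y s ** B s) (\<tau> (\<theta> - n)) $ 1 $ 1"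
      if "Y = X \<or> Y = R" for Y
    proof -
      have "row_state C N Y (\<lambda>i. ?p (Suc n - i)) (\<lambda>i. ?z (Suc n - i)) n = rs Y n"
        unfolding rs_def
      proof (rule row_state_cong)
        fix a assume a: "a < n"
        define x where "x = Suc n - a"
        \<comment> \<open>Absorbed variables have index at least 2, so they avoid the modified order
          \<open>i\<close> at index 1.\<close>
        have "x \<noteq> 1" "\<theta> - \<eta> + x = \<theta> - a" using a n \<eta> by (auto simp: x_def)
        then have "?p x = \<nu> (\<theta> - a) \<and> ?z x = \<tau> (\<theta> - a)" by simp
        then show "?p (Suc n - a) = \<nu> (\<theta> - a) \<and> ?z (Suc n - a) = \<tau> (\<theta> - a)"
          by (simp only: x_def)
      qed
      moreover have "mat_analytic_at C (?z m) \<and> mat_analytic_at N (?z m) \<and> mat_analytic_at Y (?z m)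
          \<and> mat_analytic_at B (?z m)" if "1 \<le> m" "m \<le> Suc n" for m
        using \<tau>(2-6)[of "\<theta> - \<eta> + m"] that \<open>Y = X \<or> Y = R\<close> n \<eta> by auto
      ultimately show ?thesis
        using mixed_partial_chain_row[of n n C ?z N Y B ?p] idx n
        by (simp add: matrix_mul_assoc)
    qed
    then show ?thesis
      using right[of n i] \<eta> i n idx by (simp add: G G_red)
  qed

  have 3: "mixed_partial (q + \<eta>) (splice_at q (l(q := j)) ((\<lambda>m. \<nu> (\<theta> - \<eta> + m))(1 := i)))
        (G (q + \<eta>)) (splice_at q \<sigma> (\<lambda>m. \<tau> (\<theta> - \<eta> + m)))
      = mixed_partial (q + \<eta>) (splice_at q (l(q := j)) ((\<lambda>m. \<nu> (\<theta> - \<eta> + m))(1 := i)))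
        (G_red (q + \<eta>)) (splice_at q \<sigma> (\<lambda>m. \<tau> (\<theta> - \<eta> + m)))"
    if q: "1 \<le> q" "q \<le> k" and \<eta>: "1 \<le> \<eta>" "\<eta> \<le> \<theta>"
      and j: "j \<le> l q" and i: "i \<le> \<nu> (\<theta> - \<eta> + 1)" for q \<eta> j i
  proof -
    obtain m where m: "q = Suc m" using q by (cases q) auto
    obtain n where n: "\<eta> = Suc n" using \<eta> by (cases \<eta>) auto
    have idx: "\<theta> - \<eta> + 1 = \<theta> - n" using \<eta> n by auto
    define p where "p = splice_at q (l(q := j)) ((\<lambda>m. \<nu> (\<theta> - \<eta> + m))(1 := i))"
    define z where "z = splice_at q \<sigma> (\<lambda>m. \<tau> (\<theta> - \<eta> + m))"
    \<comment> \<open>The contribution of all the points from \<open>\<tau>\<close>; the factor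
      \<open>N\<close> that follows it belongs to the variable at \<open>\<sigma> q\<close>.\<close>
    define d where "d = (\<lambda>Y. mat_deriv i (\<lambda>s. rs Y n s ** Y s) (\<tau> (\<theta> - n)))"
    have "mixed_partial (q + \<eta>) p (chain C N Y B (m + \<eta>)) z
        = mat_deriv j (\<lambda>s. d Y ** N s ** (Y s ** cs Y m s)) (\<sigma> (Suc m)) $ 1 $ 1"
      if "Y = X \<or> Y = R" for Y
    proof -
      have p: "p (Suc m) = j" "p (Suc (Suc m)) = i"
        and z: "z (Suc m) = \<sigma> (Suc m)" "z (Suc (Suc m)) = \<tau> (\<theta> - n)"
        using idx m by (auto simp: p_def z_def splice_at_def)
      have "row_state C N Y (\<lambda>i. p (Suc (m + \<eta>) - i)) (\<lambda>i. z (Suc (m + \<eta>) - i)) n = rs Y n"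
        unfolding rs_def
      proof (rule row_state_cong)
        fix a assume a: "a < n"
        define x where "x = Suc (m + \<eta>) - a"
        have "\<not> x \<le> q" "x - q \<noteq> 1" "\<theta> - \<eta> + (x - q) = \<theta> - a"
          using a n m \<eta> by (auto simp: x_def)
        then have "p x = \<nu> (\<theta> - a) \<and> z x = \<tau> (\<theta> - a)"
          by (simp add: p_def z_def splice_at_def)
        then show "p (Suc (m + \<eta>) - a) = \<nu> (\<theta> - a) \<and> z (Suc (m + \<eta>) - a) = \<tau> (\<theta> - a)"
          by (simp only: x_def)
      qed
      then have row: "row_state C N Y (\<lambda>i. p (Suc (m + \<eta>) - i)) (\<lambda>i. z (Suc (m + \<eta>) - i)) \<eta>
          = (\<lambda>s. d Y ** N s)"
        using p z by (simp add: n d_def)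
      have col: "col_state N Y B p z m = cs Y m"
        unfolding cs_def by (rule col_state_cong) (use m in \<open>auto simp: p_def z_def splice_at_def\<close>)
      have "mat_analytic_at C (z a) \<and> mat_analytic_at N (z a) \<and> mat_analytic_at Y (z a)
          \<and> mat_analytic_at B (z a)" if "1 \<le> a" "a \<le> Suc (m + \<eta>)" for a
      proof (cases "a \<le> q")
        case True
        then show ?thesis
          using \<sigma>(2-6)[of a] that q \<open>Y = X \<or> Y = R\<close> by (auto simp: z_def splice_at_def)
      next
        case False
        define x where "x = \<theta> - \<eta> + (a - q)"
        have "z a = \<tau> x" using False by (simp add: z_def x_def splice_at_def)
        moreover have "1 \<le> x" "x \<le> \<theta>" using False that m \<eta> by (auto simp: x_def)
        ultimately show ?thesis using \<tau>(2-6)[of x] \<open>Y = X \<or> Y = R\<close> by auto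
      qed
      then show ?thesis
        using mixed_partial_chain_row[of \<eta> "m + \<eta>" C z N Y B p] p z row col m by simp
    qed
    \<comment> \<open>The left part agrees by the row induction; with \<open>d X ** N s\<close> as
      the common row factor, \<open>left\<close> settles the rest.\<close>
    moreover have "d R = d X" unfolding d_def using row[of n i] n \<eta> i idx by simp
    moreover have "mat_analytic_at (\<lambda>s. d X ** N s) (\<sigma> (Suc m))"
      using \<sigma>(3)[of q] q m by auto
    ultimately have "mixed_partial (q + \<eta>) p (chain C N X B (m + \<eta>)) z
        = mixed_partial (q + \<eta>) p (chain C N R B (m + \<eta>)) z"
      using left[of "\<lambda>s. d X ** N s" m j] q j m by simp
    then show ?thesis by (simp add: p_def z_def m G G_red)
  qed

  show ?thesis using 1 2 3 by blast
qed

end
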